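(* Let $\mathcal{M}=(X,rk,m)$ be a multiplicity matroid whose underlying matroid $M=(X,rk)$ has no coloops, write $\mathfrak{M}_{\mathcal{M}}(x,y)=\sum_{i,j\ge0}b_{i,j}x^iy^j$, let $M^*=(X,rk^* )$ be the dual matroid, $m^*(A)=m(X\setminus A)$, and $\overline{F}=X\setminus F$. Then (1) $b_{0,|X|-rk(M)}=m(X)$; (2) $b_{0,|X|-rk(M)-1}=(s(M)-|X|+rk(M))m(X)+\sum_{F\in\mathcal{F}_1(M^* )}\sum_{A\subseteq F}(-1)^{|A|+1}m^*(A)$; (3) \[b_{0,|X|-rk(M)-2}=\Big(\tbinom{|X|-rk(M)}{2}-(|X|-rk(M)-1)s(M)+\sum_{F\in\mathcal{F}_2(M^* )}(s(M/\overline{F})-1)\Big)m(X)+\sum_{F\in\mathcal{F}_1(M^* )}(s(\overline{F})-|X|+rk(M)+1)\sum_{A\subseteq F}(-1)^{|A|+1}m^*(A)+\sum_{F\in\mathcal{F}_2(M^* )}\sum_{A\subseteq F}(-1)^{|A|}m^*(A);\] (4) $b_{1,|X|-rk(M)-1}=\sum_{F\in\mathcal{F}'_1(M^* )}\sum_{A\subseteq F,|A|\ge2}(-1)^{|A|}(|A|-1)m^*(A)$; (5) \[b_{1,|X|-rk(M)-2}=\sum_{F\in\mathcal{F}'_1(M^* )}(s(\overline{F})-|X|+rk(M)+1)\sum_{A\subseteq F,|A|\ge2}(-1)^{|A|}(|A|-1)m^*(A)+\sum_{F\in\mathcal{F}_2(M^* )}\sum_{A\subseteq F,|A|\ge2}(-1)^{|A|+1}(rk(M)-rk(X\setminus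 A))m^*(A);\] (6) \[b_{2,|X|-rk(M)-2}=\sum_{F\in\mathcal{F}'_1(M^* )}(s(\overline{F})-|X|+rk(M)+1)\sum_{A\subseteq F,|A|\ge3}(-1)^{|A|+1}\tbinom{|A|-1}{2}m^*(A)+\sum_{F\in\mathcal{F}_2(M^* )}\sum_{A\subseteq F,|A|\ge3}(-1)^{|A|}\tbinom{rk(M)-rk(X\setminus A)}{2}m^*(A).\]
   Context: A matroid $(X,rk)$ is a finite set with rank function $rk:2^X\to\mathbb{Z}_{\ge0}$ satisfying $rk(A)\le|A|$, monotonicity and submodularity; $rk(M)=rk(X)$. The dual matroid is $M^*=(X,rk^* )$ with $rk^*(A)=|A|+rk(X\setminus A)-rk(X)$. A coloop of $M$ is an element that is a loop of $M^*$ (i.e. $rk^*(\{e\})=0$). A multiplicity matroid $\mathcal{M}=(X,rk,m)$ is a matroid with an arbitrary function $m:2^X\to\mathbb{Z}_{>0}$; its multiplicity Tutte polynomial is $\mathfrak{M}_{\mathcal{M}}(x,y)=\sum_{A\subseteq X}m(A)(x-1)^{rk(X)-rk(A)}(y-1)^{|A|-rk(A)}$. A flat of a matroid is a set $F$ with $\{e: r(F\cup\{e\})=r(F)\}=F$; a circuit is a set $C$ with $r(C\setminus\{e\})=|C|-1=r(C)$ for all $e\in C$; a flat is cyclic if each of its elements lies in a circuit contained in it. $\mathcal{F}_i(M^* )$ (resp. $\mathcal{F}'_i(M^* )$) is the set of flats (resp. cyclic flats) of $M^*$ of rank $i$ in $M^*$. Elements $e,f$ are parallel if $r(\{e,f\})=r(\{e\})=r(\{f\})=1$;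 a parallel class is a maximal set of non-loop elements pairwise parallel; a series class of $N$ is a parallel class of $N^*$. $s(N)$ is the number of series classes of a matroid $N$; for $T\subseteq X$, $s(T)=s(M|T)$ where $M|T$ is the restriction to $T$, and $M/T$ is the contraction (the matroid on $X\setminus T$ with rank $rk(A\cup T)-rk(T)$). *)

theory Defs
  imports "HOL-Computational_Algebra.Polynomial"
begin

record 'a rank_system =
  ground :: "'a set"
  rk :: "'a set \<Rightarrow> nat"

definition matroid :: "'a rank_system \<Rightarrow> bool" where
  "matroid M \<longleftrightarrow>
     finite (ground M) \<and>
     (\<forall>A\<subseteq>ground M. rk M A \<le> card A) \<and>
     (\<forall>A B. A \<subseteq> B \<and> B \<subseteq> ground M \<longrightarrow> rk M A \<le> rk M B) \<and>
     (\<forall>A B. A \<subseteq> ground M \<and> B \<subseteq> ground M \<longrightarrow>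
        rk M (A \<union> B) + rk M (A \<inter> B) \<le> rk M A + rk M B)"

definition total_rank :: "'a rank_system \<Rightarrow> nat" where
  "total_rank M = rk M (ground M)"

text \<open>The subtractions on \<open>nat\<close> below never truncate when
  they are applied to a matroid and to subsets of its ground set.\<close>

definition dual_matroid :: "'a rank_system \<Rightarrow> 'a rank_system" where
  "dual_matroid M =
     \<lparr>ground = ground M,
      rk = (\<lambda>A. card A + rk M (ground M - A) - total_rank M)\<rparr>"

definition restrict_matroid :: "'a rank_system \<Rightarrow> 'a set \<Rightarrow> 'a rank_system" where
  "restrict_matroid M T = \<lparr>ground = T, rk = rk M\<rparr>"

definition contract_matroid :: "'a rank_system \<Rightarrow> 'a set \<Rightarrow> 'a rank_system" where
  "contract_matroid M T =
     \<lparr>ground = ground M - T, rk = (\<lambda>A. rk M (A \<union> T) - rk M T)\<rparr>"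

definition nullity :: "'a rank_system \<Rightarrow> nat" where
  "nullity M = card (ground M) - total_rank M"

definition multiplicity_tutte :: "'a rank_system \<Rightarrow> ('a set \<Rightarrow> int) \<Rightarrow> int poly poly" where
  \<comment> \<open>A polynomial in \<open>y\<close> whose coefficients are polynomials in \<open>x\<close>:
      \<open>[:[:0, 1:]:]\<close> is \<open>x\<close> and \<open>[:0, 1:]\<close> is \<open>y\<close>.\<close>
  "multiplicity_tutte M m =
     (\<Sum>A\<in>Pow (ground M).
        of_int (m A) * ([:[:0, 1:]:] - 1) ^ (total_rank M - rk M A)
                     * ([:0, 1:] - 1) ^ (card A - rk M A))"

definition multiplicity_tutte_coeff ::
    "'a rank_system \<Rightarrow> ('a set \<Rightarrow> int) \<Rightarrow> nat \<Rightarrow> int \<Rightarrow> int" where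
  \<comment> \<open>The coefficient of \<open>x\<^sup>i y\<^sup>j\<close>.  The exponent of \<open>y\<close> is an integer, so that
      \<open>j = nullity M - 2\<close> makes sense for every matroid; the coefficient is \<open>0\<close> if \<open>j < 0\<close>.\<close>
  "multiplicity_tutte_coeff M m i j =
     (if j < 0 then 0 else coeff (coeff (multiplicity_tutte M m) (nat j)) i)"

definition multiplicity_matroid :: "'a rank_system \<Rightarrow> ('a set \<Rightarrow> int) \<Rightarrow> bool" where
  "multiplicity_matroid M m \<longleftrightarrow> matroid M \<and> (\<forall>A\<subseteq>ground M. m A > 0)"

definition dual_mult :: "'a rank_system \<Rightarrow> ('a set \<Rightarrow> int) \<Rightarrow> 'a set \<Rightarrow> int" where
  "dual_mult M m A = m (ground M - A)"

definition is_loop :: "'a rank_system \<Rightarrow> 'a \<Rightarrow> bool" where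
  "is_loop M e \<longleftrightarrow> e \<in> ground M \<and> rk M {e} = 0"

definition is_coloop :: "'a rank_system \<Rightarrow> 'a \<Rightarrow> bool" where
  "is_coloop M e \<longleftrightarrow> is_loop (dual_matroid M) e"

definition is_flat :: "'a rank_system \<Rightarrow> 'a set \<Rightarrow> bool" where
  "is_flat M F \<longleftrightarrow> F \<subseteq> ground M \<and> {e \<in> ground M. rk M (F \<union> {e}) = rk M F} = F"

definition is_circuit :: "'a rank_system \<Rightarrow> 'a set \<Rightarrow> bool" where
  \<comment> \<open>Written without subtraction, which also excludes the empty set.\<close>
  "is_circuit M C \<longleftrightarrow>
     C \<subseteq> ground M \<and> rk M C + 1 = card C \<and> (\<forall>e\<in>C. rk M (C - {e}) + 1 = card C)"

definition is_cyclic_flat :: "'a rank_system \<Rightarrow> 'a set \<Rightarrow> bool" where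
  "is_cyclic_flat M F \<longleftrightarrow> is_flat M F \<and> (\<forall>e\<in>F. \<exists>C. is_circuit M C \<and> e \<in> C \<and> C \<subseteq> F)"

definition flats_of_rank :: "'a rank_system \<Rightarrow> nat \<Rightarrow> 'a set set" where
  "flats_of_rank M i = {F. is_flat M F \<and> rk M F = i}"

definition cyclic_flats_of_rank :: "'a rank_system \<Rightarrow> nat \<Rightarrow> 'a set set" where
  "cyclic_flats_of_rank M i = {F. is_cyclic_flat M F \<and> rk M F = i}"

definition parallel :: "'a rank_system \<Rightarrow> 'a \<Rightarrow> 'a \<Rightarrow> bool" where
  "parallel M e f \<longleftrightarrow>
     e \<in> ground M \<and> f \<in> ground M \<and> rk M {e, f} = 1 \<and> rk M {e} = 1 \<and> rk M {f} = 1"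

definition pairwise_parallel :: "'a rank_system \<Rightarrow> 'a set \<Rightarrow> bool" where
  "pairwise_parallel M P \<longleftrightarrow>
     P \<subseteq> {e \<in> ground M. \<not> is_loop M e} \<and> (\<forall>e\<in>P. \<forall>f\<in>P. parallel M e f)"

definition is_parallel_class :: "'a rank_system \<Rightarrow> 'a set \<Rightarrow> bool" where
  \<comment> \<open>Non-emptiness only matters if every element is a loop: then there is no parallel class.\<close>
  "is_parallel_class M P \<longleftrightarrow>
     P \<noteq> {} \<and> pairwise_parallel M P \<and> (\<forall>Q. pairwise_parallel M Q \<and> P \<subseteq> Q \<longrightarrow> Q = P)"

definition is_series_class :: "'a rank_system \<Rightarrow> 'a set \<Rightarrow> bool" where
  "is_series_class M S \<longleftrightarrow> is_parallel_class (dual_matroid M) S"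

definition num_series :: "'a rank_system \<Rightarrow> nat" where
  "num_series M = card {S. is_series_class M S}"

end

theory Submission
  imports Defs
begin

text \<open>
  Let \<open>N = M\<^sup>*\<close>, which is loopless, and \<open>n = rk(N)\<close>. Reindexing by complements, a set \<open>A\<close> contributes
  \<open>m\<^sup>*(A) (x - 1)\<^sup>a (y - 1)\<^sup>b\<close> with \<open>a = |A| - rk\<^sup>*(A)\<close> and \<open>b = n - rk\<^sup>*(A)\<close>, so the \<open>(n - k)\<close>-th
  coefficient in \<open>y\<close> only sees the sets of rank at most \<open>k\<close> in \<open>N\<close>. Sets of rank 1 or 2 are grouped
  by their closure. The sets of rank 2 inside a flat \<open>F\<close> of rank 2 are all its subsets except the empty
  set and those of rank 1; hence the subsets of a flat \<open>G\<close> of rank 1 are removed once for each flat of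
  rank 2 above \<open>G\<close>, and these flats correspond to the series classes of \<open>M\<close> restricted to \<open>X - G\<close>.
\<close>

section \<open>Flats and closure\<close>

definition closure :: "'a rank_system \<Rightarrow> 'a set \<Rightarrow> 'a set" where
  "closure M A = {e \<in> ground M. rk M (A \<union> {e}) = rk M A}"

context
  fixes M :: "'a rank_system"
  assumes M: "matroid M"
begin

section \<open>Rank axioms, minors and duals\<close>

lemma finite_ground: "finite (ground M)"
  using M by (simp add: matroid_def)

lemma finite_subset_ground: "A \<subseteq> ground M \<Longrightarrow> finite A"
  using finite_ground finite_subset by blast

lemma rk_le_card: "A \<subseteq> ground M \<Longrightarrow> rk M A \<le> card A"
  using M by (simp add: matroid_def)

lemma rk_mono: "A \<subseteq> B \<Longrightarrow> B \<subseteq> ground M \<Longrightarrow> rk M A \<le> rk M B"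
  using M by (auto simp: matroid_def)

lemma rk_submodular:
  "A \<subseteq> ground M \<Longrightarrow> B \<subseteq> ground M \<Longrightarrow> rk M (A \<union> B) + rk M (A \<inter> B) \<le> rk M A + rk M B"
  using M by (simp add: matroid_def)

lemma rk_empty: "rk M {} = 0"
  using rk_le_card[of "{}"] by simp

lemma finite_flats: "finite (flats_of_rank M i)"
  by (rule finite_subset[of _ "Pow (ground M)"])
     (auto simp: flats_of_rank_def is_flat_def finite_ground)

lemma matroid_restrict:
  assumes T: "T \<subseteq> ground M"
  shows "matroid (restrict_matroid M T)"
  unfolding matroid_def restrict_matroid_def rank_system.simps
proof (intro conjI allI impI; (elim conjE)?)
  show "finite T" using finite_subset_ground[OF T] .
next
  fix A assume "A \<subseteq> T"
  then show "rk M A \<le> card A" using T by (intro rk_le_card) auto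
next
  fix A B assume "A \<subseteq> B" "B \<subseteq> T"
  then show "rk M A \<le> rk M B" using T by (intro rk_mono) auto
next
  fix A B assume "A \<subseteq> T" "B \<subseteq> T"
  then show "rk M (A \<union> B) + rk M (A \<inter> B) \<le> rk M A + rk M B"
    using T by (intro rk_submodular) auto
qed

lemma matroid_contract:
  assumes T: "T \<subseteq> ground M"
  shows "matroid (contract_matroid M T)"
proof -
  have "rk M (A \<union> T) - rk M T \<le> card A" if A: "A \<subseteq> ground M - T" for A
    using rk_submodular[of A T] rk_le_card[of A] A T by force
  moreover have "rk M (A \<union> T) - rk M T \<le> rk M (B \<union> T) - rk M T"
    if "A \<subseteq> B" "B \<subseteq> ground M - T" for A B
    using that T by (intro diff_le_mono rk_mono) auto
  moreover have "(rk M (A \<union> B \<union> T) - rk M T) + (rk M (A \<inter> B \<union> T) - rk M T)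
      \<le> (rk M (A \<union> T) - rk M T) + (rk M (B \<union> T) - rk M T)"
    if A: "A \<subseteq> ground M - T" and B: "B \<subseteq> ground M - T" for A B
  proof -
    have "A \<union> T \<union> (B \<union> T) = A \<union> B \<union> T" "(A \<union> T) \<inter> (B \<union> T) = A \<inter> B \<union> T" by auto
    then have "rk M (A \<union> B \<union> T) + rk M (A \<inter> B \<union> T) \<le> rk M (A \<union> T) + rk M (B \<union> T)"
      using rk_submodular[of "A \<union> T" "B \<union> T"] A B T by auto
    \<comment> \<open>Since \<open>rk M T\<close> is below all four ranks, the truncated differences
      are exact and inherit submodularity.\<close>
    moreover have "rk M T \<le> rk M (A \<union> B \<union> T)" "rk M T \<le> rk M (A \<inter> B \<union> T)"
      "rk M T \<le> rk M (A \<union> T)" "rk M T \<le> rk M (B \<union> T)"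
      using A B T by (auto intro!: rk_mono)
    ultimately show ?thesis by linarith
  qed
  ultimately show ?thesis
    by (auto simp: matroid_def contract_matroid_def finite_ground)
qed

text \<open>Submodularity for \<open>C - A\<close> and \<open>A\<close>: each deleted element costs
  at most one unit of rank. This keeps the subtraction in \<open>dual_matroid\<close> from
  truncating and later gives monotonicity of the dual rank.\<close>

lemma rk_le_rk_Diff_add_card:
  assumes "A \<subseteq> ground M" "C \<subseteq> ground M" "A \<subseteq> C"
  shows "rk M C \<le> rk M (C - A) + card A"
proof -
  have "rk M C \<le> rk M ((C - A) \<union> A)"
    using assms by (intro rk_mono) auto
  then show ?thesis
    using rk_submodular[of "C - A" A] rk_le_card[of A] assms by force
qed

text \<open>An additive form of the definition, free of truncated subtraction, so that identities
  between dual ranks become linear arithmetic.\<close>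

lemma rk_dual:
  assumes "A \<subseteq> ground M"
  shows "rk (dual_matroid M) A + total_rank M = card A + rk M (ground M - A)"
  using rk_le_rk_Diff_add_card[of A "ground M"] assms
  by (simp add: dual_matroid_def total_rank_def)

text \<open>Each axiom follows by taking complements: monotonicity of \<open>rk M\<close> bounds the
  dual rank by the cardinality, the bound on rank loss gives monotonicity, and submodularity holds
  because complements exchange union and intersection while cardinality is modular.\<close>

lemma matroid_dual: "matroid (dual_matroid M)"
proof -
  let ?N = "dual_matroid M"
  have ground: "ground ?N = ground M" by (simp add: dual_matroid_def)
  have "rk ?N A \<le> card A" if A: "A \<subseteq> ground M" for A
    using rk_dual[OF A] rk_mono[of "ground M - A" "ground M"] by (simp add: total_rank_def)
  moreover have "rk ?N A \<le> rk ?N B" if AB: "A \<subseteq> B" and B: "B \<subseteq> ground M" for A B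
  proof -
    have "ground M - A - (B - A) = ground M - B" using AB by auto
    moreover have "card B = card A + card (B - A)"
      using AB B by (metis card_Un_disjoint Diff_disjoint finite_subset_ground Un_Diff_cancel
          finite_Diff finite_subset sup.absorb_iff2)
    ultimately show ?thesis
      using rk_le_rk_Diff_add_card[of "B - A" "ground M - A"] rk_dual[OF B] rk_dual[of A] AB B
      by force
  qed
  moreover have "rk ?N (A \<union> B) + rk ?N (A \<inter> B) \<le> rk ?N A + rk ?N B"
    if A: "A \<subseteq> ground M" and B: "B \<subseteq> ground M" for A B
  proof -
    have "card (A \<union> B) + card (A \<inter> B) = card A + card B"
      using card_Un_Int[of A B] finite_subset_ground A B by simp
    moreover have "ground M - (A \<union> B) = (ground M - A) \<inter> (ground M - B)"
      "ground M - (A \<inter> B) = (ground M - A) \<union> (ground M - B)" by auto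
    ultimately show ?thesis
      using rk_submodular[of "ground M - A" "ground M - B"]
        rk_dual[OF A] rk_dual[OF B] rk_dual[of "A \<union> B"] rk_dual[of "A \<inter> B"] A B
      by (simp add: le_infI1)
  qed
  ultimately show ?thesis
    by (auto simp: matroid_def ground finite_ground)
qed

section \<open>Closure, and grouping the sets of a given rank by their closure\<close>

lemma closure_subset_ground: "closure M A \<subseteq> ground M"
  by (auto simp: closure_def)

lemma subset_closure: "A \<subseteq> ground M \<Longrightarrow> A \<subseteq> closure M A"
  by (auto simp: closure_def insert_absorb)

text \<open>By submodularity, an element that does not raise the rank of \<open>A\<close> does not
  raise that of the larger set \<open>F\<close> either, so the flat \<open>F\<close> already
  contains it.\<close>

lemma closure_subset_flat:
  assumes F: "is_flat M F" and A: "A \<subseteq> F"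
  shows "closure M A \<subseteq> F"
proof
  fix e assume e: "e \<in> closure M A"
  have sub: "F \<subseteq> ground M" "e \<in> ground M" "A \<union> {e} \<subseteq> ground M"
    using F A e by (auto simp: is_flat_def closure_def)
  have "F \<union> (A \<union> {e}) = F \<union> {e}" using A by auto
  moreover have "rk M A \<le> rk M (F \<inter> (A \<union> {e}))" "rk M F \<le> rk M (F \<union> {e})"
    using sub A by (auto intro!: rk_mono)
  ultimately have "rk M (F \<union> {e}) = rk M F"
    using rk_submodular[of F "A \<union> {e}"] sub e by (simp add: closure_def)
  then show "e \<in> F" using F sub by (auto simp: is_flat_def)
qed

text \<open>Elements of the closure are adjoined one at a time. Submodularity for
  \<open>A \<union> B\<close> and \<open>A \<union> {e}\<close>, whose intersection contains
  \<open>A\<close>, shows that no step raises the rank.\<close>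

lemma rk_closure:
  assumes A: "A \<subseteq> ground M"
  shows "rk M (closure M A) = rk M A"
proof -
  have "finite B \<Longrightarrow> B \<subseteq> closure M A \<Longrightarrow> rk M (A \<union> B) = rk M A" for B
  proof (induction B rule: finite_induct)
    case (insert e B)
    have sub: "A \<union> B \<subseteq> ground M" "A \<union> {e} \<subseteq> ground M" "insert e B \<subseteq> ground M"
      using insert.prems A closure_subset_ground by auto
    have "(A \<union> B) \<union> (A \<union> {e}) = A \<union> insert e B" by auto
    moreover have "rk M A \<le> rk M ((A \<union> B) \<inter> (A \<union> {e}))" "rk M A \<le> rk M (A \<union> insert e B)"
      using sub A by (auto intro!: rk_mono)
    ultimately show ?case
      using rk_submodular[OF sub(1,2)] insert by (simp add: closure_def)
  qed simp
  from this[of "closure M A"] show ?thesis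
    using A subset_closure[OF A] closure_subset_ground finite_subset_ground
    by (simp add: sup.absorb2)
qed

lemma is_flat_closure:
  assumes A: "A \<subseteq> ground M"
  shows "is_flat M (closure M A)"
proof -
  have "e \<in> closure M A" if e: "e \<in> ground M" "rk M (closure M A \<union> {e}) = rk M (closure M A)" for e
  proof -
    have "rk M (A \<union> {e}) \<le> rk M (closure M A \<union> {e})"
      using e subset_closure[OF A] closure_subset_ground by (intro rk_mono) auto
    moreover have "rk M A \<le> rk M (A \<union> {e})"
      using e A by (intro rk_mono) auto
    ultimately have "rk M (A \<union> {e}) = rk M A" using e rk_closure[OF A] by simp
    then show ?thesis using e by (simp add: closure_def)
  qed
  then show ?thesis
    using closure_subset_ground by (auto simp: is_flat_def insert_absorb)
qed

text \<open>For \<open>e\<close> in \<open>F\<close>, the rank of \<open>A \<union> {e}\<close> is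
  squeezed between two equal ranks. Hence a set of rank \<open>i\<close> lies in exactly one flat of
  rank \<open>i\<close>, which is what makes grouping by closure possible.\<close>

lemma flat_eq_closure:
  assumes F: "is_flat M F" and A: "A \<subseteq> F" and r: "rk M A = rk M F"
  shows "F = closure M A"
proof
  show "closure M A \<subseteq> F" using F A by (rule closure_subset_flat)
  show "F \<subseteq> closure M A"
  proof
    fix e assume e: "e \<in> F"
    have "F \<subseteq> ground M" using F by (simp add: is_flat_def)
    then have "rk M (A \<union> {e}) \<le> rk M F" "rk M A \<le> rk M (A \<union> {e})" "e \<in> ground M"
      using A e by (auto intro!: rk_mono)
    then show "e \<in> closure M A" using r by (simp add: closure_def)
  qed
qed

lemma is_flat_ground: "is_flat M (ground M)"
  by (auto simp: is_flat_def insert_absorb)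

text \<open>The fibre of the closure map over \<open>G\<close> consists of the subsets of
  \<open>G\<close> that have the rank of \<open>G\<close>. Working relative to a flat
  \<open>F\<close> serves both the whole ground set and the flats of rank 2.\<close>

lemma sum_rank_eq_sum_flats:
  fixes c :: "'a set \<Rightarrow> 'b::comm_monoid_add"
  assumes F: "is_flat M F"
  shows "(\<Sum>A | A \<subseteq> F \<and> rk M A = i. c A) =
    (\<Sum>G | G \<in> flats_of_rank M i \<and> G \<subseteq> F. \<Sum>A | A \<subseteq> G \<and> rk M A = i. c A)"
proof -
  have Fg: "F \<subseteq> ground M" using F by (simp add: is_flat_def)
  have "{A \<in> {A. A \<subseteq> F \<and> rk M A = i}. closure M A = G} = {A. A \<subseteq> G \<and> rk M A = i}"
    if G: "G \<in> flats_of_rank M i" "G \<subseteq> F" for G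
  proof -
    have "A \<subseteq> F \<and> rk M A = i \<and> closure M A = G \<longleftrightarrow> A \<subseteq> G \<and> rk M A = i" for A
    proof
      assume A: "A \<subseteq> F \<and> rk M A = i \<and> closure M A = G"
      then have "A \<subseteq> closure M A" using Fg by (intro subset_closure) blast
      with A show "A \<subseteq> G \<and> rk M A = i" by simp
    next
      assume A: "A \<subseteq> G \<and> rk M A = i"
      with G have "G = closure M A" by (intro flat_eq_closure) (auto simp: flats_of_rank_def)
      with A G(2) show "A \<subseteq> F \<and> rk M A = i \<and> closure M A = G" by (blast intro: sym)
    qed
    then show ?thesis by simp
  qed
  moreover have "(\<Sum>A | A \<subseteq> F \<and> rk M A = i. c A) =
      (\<Sum>G | G \<in> flats_of_rank M i \<and> G \<subseteq> F. \<Sum>A \<in> {A \<in> {A. A \<subseteq> F \<and> rk M A = i}. closure M A = G}. c A)"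
  proof (rule sum.group[symmetric])
    show "finite {A. A \<subseteq> F \<and> rk M A = i}"
      using finite_subset_ground[OF Fg] by simp
    show "finite {G. G \<in> flats_of_rank M i \<and> G \<subseteq> F}" using finite_flats by simp
    show "closure M ` {A. A \<subseteq> F \<and> rk M A = i} \<subseteq> {G. G \<in> flats_of_rank M i \<and> G \<subseteq> F}"
    proof (rule image_subsetI)
      fix A assume "A \<in> {A. A \<subseteq> F \<and> rk M A = i}"
      then show "closure M A \<in> {G. G \<in> flats_of_rank M i \<and> G \<subseteq> F}"
        using is_flat_closure[of A] rk_closure[of A] closure_subset_flat[OF F, of A] Fg
        by (auto simp: flats_of_rank_def)
    qed
  qed
  ultimately show ?thesis by simp
qed

end

section \<open>Loopless matroids: parallel and series classes as flats of rank 1\<close>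

lemma is_flat_iff:
  "is_flat M A \<longleftrightarrow>
    A \<subseteq> ground M \<and> (\<forall>e\<in>ground M - A. rk M (A \<union> {e}) \<noteq> rk M A)"
  by (auto simp: is_flat_def insert_absorb)

lemma rk_pos_if_loopless:
  assumes M: "matroid M" and loopless: "\<And>e. \<not> is_loop M e" and A: "A \<subseteq> ground M" "A \<noteq> {}"
  shows "0 < rk M A"
proof -
  obtain e where e: "e \<in> A" using A by auto
  then have "rk M {e} \<noteq> 0" using loopless[of e] A by (auto simp: is_loop_def)
  moreover have "rk M {e} \<le> rk M A" using rk_mono[OF M, of "{e}" A] e A by simp
  ultimately show ?thesis by simp
qed

text \<open>Without loops, the nonempty pairwise parallel sets are exactly the sets of rank 1, and
  such a set is maximal precisely when it is closed.\<close>

lemma parallel_classes_eq_flats: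
  assumes M: "matroid M" and loopless: "\<And>e. \<not> is_loop M e"
  shows "{P. is_parallel_class M P} = flats_of_rank M 1"
proof -
  have pos: "0 < rk M A" if "A \<subseteq> ground M" "A \<noteq> {}" for A
    using rk_pos_if_loopless[OF M loopless that] .
  have rk1: "P \<subseteq> ground M \<and> rk M P = 1" if P: "pairwise_parallel M P" "P \<noteq> {}" for P
  proof -
    obtain e where e: "e \<in> P" using P by auto
    have Pg: "P \<subseteq> ground M" using P by (auto simp: pairwise_parallel_def)
    have par: "parallel M e f" if "f \<in> P" for f
      using P e that by (auto simp: pairwise_parallel_def)
    \<comment> \<open>All elements parallel to the fixed \<open>e\<close> lie in the closure of
      \<open>{e}\<close>, which has rank 1, so \<open>P\<close> cannot have larger rank.\<close>
    have "f \<in> closure M {e}" if "f \<in> P" for f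
      using par[OF that] by (simp add: closure_def parallel_def insert_commute)
    then have "rk M P \<le> rk M (closure M {e})"
      by (intro rk_mono[OF M] closure_subset_ground[OF M]) auto
    also have "\<dots> = 1"
      using rk_closure[OF M, of "{e}"] par[OF e] Pg e by (simp add: parallel_def)
    finally show ?thesis using pos[OF Pg P(2)] Pg by simp
  qed
  have pp: "pairwise_parallel M Q" if Q: "Q \<subseteq> ground M" "rk M Q = 1" for Q
  proof -
    have "rk M A = 1" if "A \<subseteq> Q" "A \<noteq> {}" for A
      using pos[OF order_trans[OF that(1) Q(1)] that(2)] rk_mono[OF M that(1) Q(1)] Q(2) by simp
    then show ?thesis
      using Q loopless by (auto simp: pairwise_parallel_def parallel_def)
  qed
  show ?thesis
  proof (intro equalityI subsetI CollectI)
    fix P assume "P \<in> {P. is_parallel_class M P}"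
    then have P: "pairwise_parallel M P" "P \<noteq> {}"
      and max: "\<And>Q. pairwise_parallel M Q \<Longrightarrow> P \<subseteq> Q \<Longrightarrow> Q = P"
      by (auto simp: is_parallel_class_def)
    note r = rk1[OF P]
    have "closure M P = P"
      using r by (intro max pp) (simp_all add: rk_closure[OF M] closure_subset_ground[OF M]
          subset_closure[OF M])
    then show "P \<in> flats_of_rank M 1"
      using is_flat_closure[OF M, of P] r by (simp add: flats_of_rank_def)
  next
    fix F assume "F \<in> flats_of_rank M 1"
    then have F: "is_flat M F" "rk M F = 1" "F \<subseteq> ground M"
      by (auto simp: flats_of_rank_def is_flat_def)
    have "Q = F" if Q: "pairwise_parallel M Q" "F \<subseteq> Q" for Q
    proof -
      have "F \<noteq> {}" using F rk_empty[OF M] by auto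
      with Q have r: "Q \<subseteq> ground M" "rk M Q = 1" using rk1[of Q] by auto
      have "Q \<subseteq> closure M Q" using subset_closure[OF M r(1)] .
      \<comment> \<open>\<open>F\<close> lies in the closure of \<open>Q\<close> and has the same
        rank, so both span the same flat, which is \<open>F\<close> itself.\<close>
      also have "closure M Q = closure M F"
      proof (rule flat_eq_closure[OF M is_flat_closure[OF M r(1)]])
        show "F \<subseteq> closure M Q" using Q subset_closure[OF M r(1)] by simp
        show "rk M F = rk M (closure M Q)" using F r rk_closure[OF M r(1)] by simp
      qed
      also have "\<dots> = F" using flat_eq_closure[OF M F(1), of F] by simp
      finally show ?thesis using Q by simp
    qed
    moreover have "F \<noteq> {}" using F rk_empty[OF M] by auto
    ultimately show "is_parallel_class M F"
      using pp F by (auto simp: is_parallel_class_def)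
  qed
qed

text \<open>Series classes are parallel classes of the dual, and absence of coloops is looplessness
  of the dual.\<close>

lemma num_series_eq_card_flats:
  assumes "matroid M" "\<And>e. \<not> is_coloop M e"
  shows "num_series M = card (flats_of_rank (dual_matroid M) 1)"
  using parallel_classes_eq_flats[OF matroid_dual[OF assms(1)]] assms(2)
  by (simp add: num_series_def is_series_class_def is_coloop_def)

section \<open>Series classes of minors as flats of the dual\<close>

lemma ground_dual: "ground (dual_matroid M) = ground M"
  by (simp add: dual_matroid_def)

text \<open>Duality turns deletion of \<open>F\<close> into contraction of \<open>F\<close>: this is
  the rank formula of a contraction of the dual, written additively.\<close>

lemma rk_dual_restrict:
  assumes M: "matroid M" and F: "F \<subseteq> ground M" and A: "A \<subseteq> ground M - F"
  shows "rk (dual_matroid (restrict_matroid M (ground M - F))) A + rk (dual_matroid M) F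
    = rk (dual_matroid M) (A \<union> F)"
proof -
  let ?R = "restrict_matroid M (ground M - F)"
  have g: "ground ?R = ground M - F" "rk ?R = rk M" by (simp_all add: restrict_matroid_def)
  have "card (A \<union> F) = card A + card F"
    using A F finite_subset_ground[OF M] by (intro card_Un_disjoint) auto
  moreover have "ground M - (A \<union> F) = ground M - F - A" by auto
  moreover have "A \<union> F \<subseteq> ground M" using A F by auto
  ultimately show ?thesis
    using rk_dual[OF matroid_restrict[OF M], of "ground M - F" A] rk_dual[OF M F]
      rk_dual[OF M, of "A \<union> F"] A
    by (simp add: g total_rank_def)
qed

text \<open>Duality turns contraction of the complement of \<open>F\<close> into its deletion, that
  is, into restriction of the dual to \<open>F\<close>.\<close>

lemma rk_dual_contract:
  assumes M: "matroid M" and F: "F \<subseteq> ground M" and A: "A \<subseteq> F"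
  shows "rk (dual_matroid (contract_matroid M (ground M - F))) A = rk (dual_matroid M) A"
proof -
  let ?T = "ground M - F"
  let ?C = "contract_matroid M ?T"
  have g: "ground ?C = F" "\<And>A. rk ?C A = rk M (A \<union> ?T) - rk M ?T"
    using F by (auto simp: contract_matroid_def)
  have "F - A \<union> ?T = ground M - A" "F \<union> ?T = ground M" using A F by auto
  moreover have "rk M ?T \<le> rk M (ground M - A)" "rk M ?T \<le> rk M (ground M)"
    using A by (auto intro!: rk_mono[OF M])
  ultimately show ?thesis
    using rk_dual[OF matroid_contract[OF M], of ?T A] rk_dual[OF M order_trans[OF A F]] A F
    by (simp add: g total_rank_def Nat.le_imp_diff_is_add del: Un_Diff_cancel Un_Diff_cancel2)
qed

text \<open>The dual of this restriction is the dual of \<open>M\<close> contracted by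
  \<open>F\<close>. Adjoining \<open>F\<close> turns its flats into the flats above \<open>F\<close>
  and raises ranks by the rank of \<open>F\<close>. It is loopless because \<open>F\<close> is a
  flat.\<close>

lemma num_series_restrict:
  assumes M: "matroid M" and F: "is_flat (dual_matroid M) F"
  shows "num_series (restrict_matroid M (ground M - F)) =
    card {G \<in> flats_of_rank (dual_matroid M) (rk (dual_matroid M) F + 1). F \<subseteq> G}"
proof -
  let ?N = "dual_matroid M"
  let ?R = "restrict_matroid M (ground M - F)"
  let ?K = "dual_matroid ?R"
  have Fg: "F \<subseteq> ground M" using F by (simp add: is_flat_def ground_dual)
  have R: "matroid ?R" using matroid_restrict[OF M] by simp
  have g: "ground ?R = ground M - F" by (simp add: restrict_matroid_def)
  note rkK = rk_dual_restrict[OF M Fg]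
  have loopless: "\<not> is_coloop ?R e" for e
  proof
    assume "is_coloop ?R e"
    then have "e \<in> ground M - F" "rk ?K {e} = 0" by (auto simp: is_coloop_def is_loop_def g ground_dual)
    then have "e \<in> ground M - F" "rk ?N (F \<union> {e}) = rk ?N F"
      using rkK[of "{e}"] by simp_all
    then show False using F unfolding is_flat_iff ground_dual by blast
  qed
  have flat: "is_flat ?K A \<longleftrightarrow> is_flat ?N (A \<union> F)" if A: "A \<subseteq> ground M - F" for A
  proof -
    have step: "rk ?K (A \<union> {e}) \<noteq> rk ?K A \<longleftrightarrow> rk ?N (A \<union> F \<union> {e}) \<noteq> rk ?N (A \<union> F)"
      if "e \<in> ground M - F - A" for e
    proof -
      have Ae: "A \<union> {e} \<union> F = A \<union> F \<union> {e}" "A \<union> {e} \<subseteq> ground M - F" using that A by auto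
      show ?thesis using rkK[OF Ae(2)] rkK[OF A] unfolding Ae(1) by linarith
    qed
    have "ground M - (A \<union> F) = ground M - F - A" "A \<union> F \<subseteq> ground M" using A Fg by auto
    then show ?thesis
      unfolding is_flat_iff ground_dual g using A by (simp only: step cong: ball_cong)
  qed
  have "bij_betw (\<lambda>A. A \<union> F) (flats_of_rank ?K 1)
      {G \<in> flats_of_rank ?N (rk ?N F + 1). F \<subseteq> G}"
  proof (rule bij_betw_byWitness[where f' = "\<lambda>G. G - F"])
    show "\<forall>A\<in>flats_of_rank ?K 1. A \<union> F - F = A"
      by (auto simp: flats_of_rank_def is_flat_def g ground_dual)
    show "\<forall>G\<in>{G \<in> flats_of_rank ?N (rk ?N F + 1). F \<subseteq> G}. G - F \<union> F = G" by auto
    show "(\<lambda>A. A \<union> F) ` flats_of_rank ?K 1 \<subseteq> {G \<in> flats_of_rank ?N (rk ?N F + 1). F \<subseteq> G}"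
    proof (rule image_subsetI)
      fix A assume A: "A \<in> flats_of_rank ?K 1"
      then have "A \<subseteq> ground M - F" by (auto simp: flats_of_rank_def is_flat_def g ground_dual)
      with A show "A \<union> F \<in> {G \<in> flats_of_rank ?N (rk ?N F + 1). F \<subseteq> G}"
        using flat[of A] rkK[of A] by (simp add: flats_of_rank_def)
    qed
    show "(\<lambda>G. G - F) ` {G \<in> flats_of_rank ?N (rk ?N F + 1). F \<subseteq> G} \<subseteq> flats_of_rank ?K 1"
    proof (rule image_subsetI)
      fix G assume G: "G \<in> {G \<in> flats_of_rank ?N (rk ?N F + 1). F \<subseteq> G}"
      then have "G - F \<subseteq> ground M - F" "G - F \<union> F = G"
        by (auto simp: flats_of_rank_def is_flat_def ground_dual)
      with G show "G - F \<in> flats_of_rank ?K 1"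
        using flat[of "G - F"] rkK[of "G - F"] by (simp add: flats_of_rank_def)
    qed
  qed
  then show ?thesis
    using num_series_eq_card_flats[OF R loopless] by (simp only: bij_betw_same_card)
qed

text \<open>The dual of this contraction is the dual of \<open>M\<close> restricted to
  \<open>F\<close>. As \<open>F\<close> is closed, the flats of the restriction are the flats of the
  whole dual that lie in \<open>F\<close>.\<close>

lemma num_series_contract:
  assumes M: "matroid M" and no_coloop: "\<And>e. \<not> is_coloop M e" and F: "is_flat (dual_matroid M) F"
  shows "num_series (contract_matroid M (ground M - F)) =
    card {G \<in> flats_of_rank (dual_matroid M) 1. G \<subseteq> F}"
proof -
  let ?N = "dual_matroid M"
  let ?C = "contract_matroid M (ground M - F)"
  let ?K = "dual_matroid ?C"
  have Fg: "F \<subseteq> ground M" using F by (simp add: is_flat_def ground_dual)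
  have C: "matroid ?C" using matroid_contract[OF M] by simp
  have g: "ground ?C = F" using Fg by (auto simp: contract_matroid_def)
  note rkK = rk_dual_contract[OF M Fg]
  have loopless: "\<not> is_coloop ?C e" for e
  proof
    assume "is_coloop ?C e"
    then have "e \<in> F" "rk ?K {e} = 0" by (auto simp: is_coloop_def is_loop_def g ground_dual)
    then have "e \<in> ground M" "rk ?N {e} = 0" using rkK[of "{e}"] Fg by auto
    then show False
      using no_coloop[of e] by (simp add: is_coloop_def is_loop_def ground_dual)
  qed
  have flat: "is_flat ?K A \<longleftrightarrow> is_flat ?N A" if A: "A \<subseteq> F" for A
  proof -
    have "closure ?N A \<subseteq> F" using closure_subset_flat[OF matroid_dual[OF M] F A] .
    \<comment> \<open>An element outside \<open>F\<close> is never in the closure of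
      \<open>A\<close>, so only the elements of \<open>F\<close> decide whether \<open>A\<close> is
      a flat.\<close>
    then have outside: "rk ?N (A \<union> {e}) \<noteq> rk ?N A" if "e \<in> ground M - F" for e
      using that unfolding closure_def ground_dual by blast
    have inside: "rk ?K (A \<union> {e}) = rk ?N (A \<union> {e})" if "e \<in> F - A" for e
      using that A by (intro rkK) simp
    have "ground M - A = (F - A) \<union> (ground M - F)" using A Fg by auto
    then have "(\<forall>e\<in>ground M - A. rk ?N (A \<union> {e}) \<noteq> rk ?N A) \<longleftrightarrow>
        (\<forall>e\<in>F - A. rk ?N (A \<union> {e}) \<noteq> rk ?N A)"
      using outside by (simp only: ball_Un) blast
    then show ?thesis
      unfolding is_flat_iff ground_dual g rkK[OF A] using A Fg
      by (simp only: inside order_trans[OF A Fg] cong: ball_cong)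
  qed
  have "is_flat ?K A \<Longrightarrow> A \<subseteq> F" for A by (simp add: is_flat_iff g ground_dual)
  then have "is_flat ?K A \<and> rk ?K A = 1 \<longleftrightarrow> (is_flat ?N A \<and> rk ?N A = 1) \<and> A \<subseteq> F" for A
    using flat[of A] rkK[of A] by (cases "A \<subseteq> F") auto
  then have "flats_of_rank ?K 1 = {G \<in> flats_of_rank ?N 1. G \<subseteq> F}"
    by (simp only: flats_of_rank_def mem_Collect_eq)
  then show ?thesis using num_series_eq_card_flats[OF C loopless] by simp
qed

text \<open>Without loops, two distinct elements of a flat of rank 1 form a circuit, so an element
  on no circuit inside the flat is alone in it. Sums whose terms vanish on singletons can therefore
  switch between the two families.\<close>

lemma cyclic_flats_of_rank_one:
  assumes M: "matroid M" and loopless: "\<And>e. \<not> is_loop M e"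
  shows "cyclic_flats_of_rank M 1 \<subseteq> flats_of_rank M 1"
    and "F \<in> flats_of_rank M 1 - cyclic_flats_of_rank M 1 \<Longrightarrow> card F \<le> 1"
proof -
  show "cyclic_flats_of_rank M 1 \<subseteq> flats_of_rank M 1"
    by (auto simp: cyclic_flats_of_rank_def flats_of_rank_def is_cyclic_flat_def)
  assume F: "F \<in> flats_of_rank M 1 - cyclic_flats_of_rank M 1"
  then have Fg: "F \<subseteq> ground M" "rk M F = 1" by (auto simp: flats_of_rank_def is_flat_def)
  from F obtain e where e: "e \<in> F" "\<And>C. is_circuit M C \<Longrightarrow> e \<in> C \<Longrightarrow> \<not> C \<subseteq> F"
    by (auto simp: cyclic_flats_of_rank_def flats_of_rank_def is_cyclic_flat_def)
  have rk1: "rk M A = 1" if "A \<subseteq> F" "A \<noteq> {}" for A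
    using rk_pos_if_loopless[OF M loopless, of A] rk_mono[OF M that(1)] Fg that by fastforce
  have "f = e" if f: "f \<in> F" for f
  proof (rule ccontr)
    assume ne: "f \<noteq> e"
    then have "{e, f} - {e} = {f}" "{e, f} - {f} = {e}" by auto
    then have "is_circuit M {e, f}"
      using ne e f rk1[of "{e, f}"] rk1[of "{e}"] rk1[of "{f}"] Fg by (auto simp: is_circuit_def)
    then show False using e f by auto
  qed
  then have "F \<subseteq> {e}" by auto
  then show "card F \<le> 1" using card_mono[of "{e}" F] by simp
qed

section \<open>Coefficients of the multiplicity Tutte polynomial\<close>

text \<open>The binomial theorem. For \<open>i > n\<close> the truncated exponent
  \<open>n - i\<close> is harmless because \<open>n choose i\<close> is 0.\<close>

lemma coeff_X_minus_1_power:
  "coeff (([:0, 1:] - 1 :: 'a::comm_ring_1 poly) ^ n) i = of_nat (n choose i) * (- 1) ^ (n - i)"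
proof -
  have "[:0, 1:] - 1 = ([:- 1, 1:] :: 'a poly)" by (simp add: one_pCons)
  moreover have "coeff ([:- 1, 1:] ^ n) i = (0 :: 'a)" if "i > n"
    using that degree_power_le[of "[:- 1, 1:] :: 'a poly" n] degree_pCons_le[of "- 1" "1 :: 'a poly"]
    by (intro coeff_eq_0) auto
  ultimately show ?thesis
    by (cases "i \<le> n") (simp_all add: coeff_linear_poly_power binomial_eq_0)
qed

lemma coeff_multiplicity_tutte:
  "coeff (coeff (multiplicity_tutte M m) j) i =
    (\<Sum>A\<in>Pow (ground M). m A
      * (int ((total_rank M - rk M A) choose i) * (- 1) ^ (total_rank M - rk M A - i))
      * (int ((card A - rk M A) choose j) * (- 1) ^ (card A - rk M A - j)))"
proof -
  \<comment> \<open>As a polynomial in \<open>y\<close>, \<open>x - 1\<close> is constant, so its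
    powers only affect the inner coefficients.\<close>
  have x: "[:[:0, 1:]:] - 1 = ([:[:0, 1:] - 1:] :: int poly poly)" by (simp add: one_pCons)
  have c: "of_nat a * (- 1) ^ b = [:int a * (- 1) ^ b:]" for a b
    by (simp add: of_nat_poly poly_const_pow flip: of_int_poly)
       (simp add: minus_one_power_iff of_nat_poly)
  have "coeff (coeff (of_int k * ([:[:0, 1:]:] - 1) ^ a * ([:0, 1:] - 1) ^ b) j) i =
      k * (int (a choose i) * (- 1) ^ (a - i)) * (int (b choose j) * (- 1) ^ (b - j))" for k a b
    unfolding x of_int_poly poly_const_pow
    by (simp add: coeff_X_minus_1_power c mult_ac)
  then show ?thesis by (simp add: multiplicity_tutte_def coeff_sum)
qed

text \<open>The sign is that of \<open>(- 1) ^ (card A - rk N A - i)\<close> up to a factor depending only on \<open>i\<close> and the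
  rank, so that sums over sets of different ranks can be combined.\<close>

definition signed_term :: "'a rank_system \<Rightarrow> ('a set \<Rightarrow> int) \<Rightarrow> nat \<Rightarrow> 'a set \<Rightarrow> int" where
  "signed_term N w i A = (- 1) ^ card A * int ((card A - rk N A) choose i) * w A"

text \<open>The nullity of \<open>M\<close> is the total rank of the dual.\<close>

lemma rk_dual_le_nullity:
  assumes M: "matroid M" and A: "A \<subseteq> ground M"
  shows "rk (dual_matroid M) A \<le> nullity M"
  using rk_dual[OF M, of "ground M"] rk_mono[OF matroid_dual[OF M], of A "ground M"] A
  by (simp add: nullity_def ground_dual rk_empty[OF M])

text \<open>Let \<open>R\<close> be the nullity and \<open>r\<close> the dual rank of
  \<open>A\<close>. The \<open>y\<close>-factor of the complement of \<open>A\<close> contributes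
  \<open>(R - r) choose (R - k)\<close>, which vanishes for \<open>r > k\<close> and equals
  \<open>(R - r) choose (k - r)\<close> otherwise. This weight depends on the rank alone, so the sum
  can be sorted by rank.\<close>

lemma multiplicity_tutte_coeff_eq:
  assumes M: "matroid M"
  shows "multiplicity_tutte_coeff M m i (int (nullity M) - int k) =
    (- 1) ^ (k + i) * (\<Sum>j\<le>k. int ((nullity M - j) choose (k - j)) *
      (\<Sum>A | A \<subseteq> ground M \<and> rk (dual_matroid M) A = j.
        signed_term (dual_matroid M) (dual_mult M m) i A))"
proof -
  define X R r where "X = ground M" and "R = nullity M" and "r = rk (dual_matroid M)"
  define t where "t = signed_term (dual_matroid M) (dual_mult M m) i"
  have fin: "finite (Pow X)" using finite_ground[OF M] by (simp add: X_def)
  have rR: "r A \<le> R" if "A \<subseteq> X" for A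
    using rk_dual_le_nullity[OF M, of A] that by (simp add: r_def R_def X_def)
  have rc: "r A \<le> card A" if "A \<subseteq> X" for A
    using rk_le_card[OF matroid_dual[OF M], of A] that by (simp add: ground_dual r_def X_def)
  show ?thesis
  proof (cases "k \<le> R")
    case True
    have "coeff (coeff (multiplicity_tutte M m) (R - k)) i =
      (\<Sum>A\<in>Pow X. m A
      * (int ((total_rank M - rk M A) choose i) * (- 1) ^ (total_rank M - rk M A - i))
      * (int ((card A - rk M A) choose (R - k)) * (- 1) ^ (card A - rk M A - (R - k))))"
      by (simp add: coeff_multiplicity_tutte X_def)
    also have "\<dots> = (\<Sum>A\<in>Pow X. if r A \<le> k
        then (- 1) ^ (k + i) * (int ((R - r A) choose (k - r A)) * t A) else 0)"
    proof (rule sum.reindex_bij_witness[where i = "\<lambda>A. X - A" and j = "\<lambda>A. X - A"])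
      fix B assume "B \<in> Pow X"
      then have B: "B \<subseteq> X" by simp
      define A where "A = X - B"
      have A: "A \<subseteq> X" "X - A = B" using B by (auto simp: A_def)
      have "rk M B \<le> rk M X" "rk M X \<le> card X" "rk M B \<le> card B"
        using B rk_mono[OF M, of B X] rk_le_card[OF M] by (simp_all add: X_def)
      moreover have "card X = card A + card B"
        using A B fin card_Diff_subset[of B X] card_mono[of X B] finite_subset[of B X]
        by (simp add: A_def)
      moreover have "r A + rk M X = card A + rk M B"
        using rk_dual[OF M, of A] A by (simp add: r_def X_def total_rank_def)
      ultimately have e: "total_rank M - rk M B = card A - r A" "card B - rk M B = R - r A"
        by (simp_all add: R_def nullity_def total_rank_def X_def)
      \<comment> \<open>The side conditions keep the subtractions on \<open>nat\<close> exact. The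
        exponents on the two sides then differ by \<open>2 * (r A + i)\<close>, so the sign depends
        on \<open>A\<close> only through \<open>card A\<close>.\<close>
      have sign: "(- 1) ^ (card A - r A - i) * (- 1) ^ (R - r A - (R - k)) =
          ((- 1) ^ (k + i) * (- 1) ^ card A :: int)" if "r A \<le> k" "i \<le> card A - r A"
      proof -
        have "R - r A - (R - k) = k - r A" using that True by simp
        then have "k + i + card A = (card A - r A - i) + (R - r A - (R - k)) + 2 * (r A + i)"
          using that rc[OF A(1)] by simp
        then show ?thesis
          by (simp only: power_add[symmetric]) (simp add: power_add power_mult)
      qed
      have choose: "(R - r A) choose (R - k) = (R - r A) choose (k - r A)" if "r A \<le> k"
        using that True binomial_symmetric[of "k - r A" "R - r A"] by simp
      have *: "m B * (int ((card A - r A) choose i) * (- 1) ^ (card A - r A - i))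
          * (int ((R - r A) choose (R - k)) * (- 1) ^ (R - r A - (R - k))) =
        (if r A \<le> k then (- 1) ^ (k + i) * (int ((R - r A) choose (k - r A)) * t A) else 0)"
      \<comment> \<open>Outside this case both sides are 0: for \<open>r A > k\<close> because
        \<open>R - r A < R - k\<close>, and for \<open>i > card A - r A\<close> because the binomial
        in \<open>i\<close> vanishes.\<close>
      proof (cases "r A \<le> k \<and> i \<le> card A - r A")
        case True
        have "m B * (int ((card A - r A) choose i) * (- 1) ^ (card A - r A - i))
          * (int ((R - r A) choose (R - k)) * (- 1) ^ (R - r A - (R - k))) =
          m B * int ((card A - r A) choose i) * int ((R - r A) choose (R - k))
           * ((- 1) ^ (card A - r A - i) * (- 1) ^ (R - r A - (R - k)))"
          by (simp only: mult_ac)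
        also have "\<dots> = m B * int ((card A - r A) choose i) * int ((R - r A) choose (k - r A))
           * ((- 1) ^ (k + i) * (- 1) ^ card A)"
          using True by (simp only: sign choose)
        also have "\<dots> = (- 1) ^ (k + i) * (int ((R - r A) choose (k - r A)) * t A)"
          using A by (simp only: t_def signed_term_def dual_mult_def r_def X_def mult_ac)
        finally show ?thesis using True by simp
      next
        case False
        then show ?thesis
          using \<open>k \<le> R\<close> rR[OF A(1)]
          by (auto simp: t_def signed_term_def binomial_eq_0 simp flip: r_def)
      qed
      show "(if r (X - B) \<le> k
          then (- 1) ^ (k + i) * (int ((R - r (X - B)) choose (k - r (X - B))) * t (X - B)) else 0) =
        m B * (int ((total_rank M - rk M B) choose i) * (- 1) ^ (total_rank M - rk M B - i))
        * (int ((card B - rk M B) choose (R - k)) * (- 1) ^ (card B - rk M B - (R - k)))"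
        unfolding e * A_def[symmetric] ..
    qed auto
    also have "\<dots> = (\<Sum>A | A \<in> Pow X \<and> r A \<le> k.
        (- 1) ^ (k + i) * (int ((R - r A) choose (k - r A)) * t A))"
      using fin by (simp add: sum.If_cases Int_def)
    also have "\<dots> = (\<Sum>j\<le>k. \<Sum>A\<in>{A \<in> {A. A \<in> Pow X \<and> r A \<le> k}. r A = j}.
        (- 1) ^ (k + i) * (int ((R - r A) choose (k - r A)) * t A))"
      using fin by (intro sum.group[symmetric]) auto
    also have "\<dots> = (\<Sum>j\<le>k. \<Sum>A | A \<subseteq> X \<and> r A = j.
        (- 1) ^ (k + i) * (int ((R - j) choose (k - j)) * t A))"
      by (intro sum.cong) auto
    finally show ?thesis
      using True
      by (simp add: multiplicity_tutte_coeff_def sum_distrib_left nat_diff_distrib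
          flip: R_def X_def r_def t_def)
  next
    case False
    \<comment> \<open>The exponent of \<open>y\<close> is now negative and the left side is 0 by
      convention. On the right, \<open>k - j > R - j\<close> kills the binomial for
      \<open>j \<le> R\<close>; for \<open>j > R\<close> the truncated \<open>R - j\<close> might
      leave a nonzero binomial, but no set has such a rank.\<close>
    have "int ((R - j) choose (k - j)) * (\<Sum>A | A \<subseteq> X \<and> r A = j. t A) = 0" for j
    proof (cases "j \<le> R")
      case True
      then show ?thesis using False by (simp add: binomial_eq_0)
    next
      case False
      then have "{A. A \<subseteq> X \<and> r A = j} = {}" using rR by auto
      then show ?thesis by (simp only: sum.empty mult_zero_right)
    qed
    then have "(\<Sum>j\<le>k. int ((R - j) choose (k - j)) * (\<Sum>A | A \<subseteq> X \<and> r A = j. t A)) = 0"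
      by (intro sum.neutral) blast
    then show ?thesis
      using False
      by (simp add: multiplicity_tutte_coeff_def flip: R_def X_def r_def t_def)
  qed
qed

section \<open>Sums over the sets of rank 1 and 2 in a loopless matroid\<close>

lemma sum_rank_two:
  fixes c :: "'a set \<Rightarrow> int"
  assumes N: "matroid N" and loopless: "\<And>e. \<not> is_loop N e"
  shows "(\<Sum>A | A \<subseteq> ground N \<and> rk N A = 2. c A) =
    (\<Sum>F\<in>flats_of_rank N 2. \<Sum>A\<in>Pow F. c A) - int (card (flats_of_rank N 2)) * c {}
    - (\<Sum>G\<in>flats_of_rank N 1. int (card {F \<in> flats_of_rank N 2. G \<subseteq> F})
        * (\<Sum>A | A \<subseteq> G \<and> rk N A = 1. c A))"
proof -
  let ?U = "\<lambda>G. \<Sum>A | A \<subseteq> G \<and> rk N A = 1. c A"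
  have "(\<Sum>A | A \<subseteq> F \<and> rk N A = 2. c A) =
      (\<Sum>A\<in>Pow F. c A) - c {} - (\<Sum>G | G \<in> flats_of_rank N 1 \<and> G \<subseteq> F. ?U G)"
    if F: "F \<in> flats_of_rank N 2" for F
  proof -
    have Fg: "F \<subseteq> ground N" and flat: "is_flat N F" and r: "rk N F = 2"
      using F by (auto simp: flats_of_rank_def is_flat_def)
    have fin: "finite F" using finite_subset_ground[OF N Fg] .
    \<comment> \<open>Looplessness excludes rank 0 for nonempty sets, so \<open>Pow F\<close> splits
      into the empty set, the sets of rank 1 and those of rank 2.\<close>
    have "rk N A = 1 \<or> rk N A = 2" if "A \<subseteq> F" "A \<noteq> {}" for A
      using rk_pos_if_loopless[OF N loopless order_trans[OF that(1) Fg] that(2)]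
        rk_mono[OF N that(1) Fg] r by linarith
    then have "Pow F = {{}} \<union> ({A. A \<subseteq> F \<and> rk N A = 1} \<union> {A. A \<subseteq> F \<and> rk N A = 2})"
      by auto
    then have "(\<Sum>A\<in>Pow F. c A) =
        sum c ({{}} \<union> ({A. A \<subseteq> F \<and> rk N A = 1} \<union> {A. A \<subseteq> F \<and> rk N A = 2}))"
      by (rule arg_cong)
    also have "\<dots> = c {} + (?U F + (\<Sum>A | A \<subseteq> F \<and> rk N A = 2. c A))"
    proof -
      have "{A. A \<subseteq> F \<and> rk N A = 1} \<inter> {A. A \<subseteq> F \<and> rk N A = 2} = {}" by auto
      then show ?thesis
        using fin rk_empty[OF N] by (simp add: sum.union_disjoint)
    qed
    finally show ?thesis
      using sum_rank_eq_sum_flats[OF N flat, of c 1] by simp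
  qed
  then have "(\<Sum>A | A \<subseteq> ground N \<and> rk N A = 2. c A) =
      (\<Sum>F\<in>flats_of_rank N 2. (\<Sum>A\<in>Pow F. c A) - c {}
        - (\<Sum>G | G \<in> flats_of_rank N 1 \<and> G \<subseteq> F. ?U G))"
    by (subst sum_rank_eq_sum_flats[OF N is_flat_ground[OF N]], intro sum.cong)
       (auto simp: flats_of_rank_def is_flat_def)
  also have "\<dots> = (\<Sum>F\<in>flats_of_rank N 2. \<Sum>A\<in>Pow F. c A)
      - int (card (flats_of_rank N 2)) * c {}
      - (\<Sum>F\<in>flats_of_rank N 2. \<Sum>G | G \<in> flats_of_rank N 1 \<and> G \<subseteq> F. ?U G)"
    by (simp add: sum_subtractf)
  \<comment> \<open>Exchanging the sums makes each flat \<open>G\<close> of rank 1 count once for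
    every flat of rank 2 containing it.\<close>
  also have "(\<Sum>F\<in>flats_of_rank N 2. \<Sum>G | G \<in> flats_of_rank N 1 \<and> G \<subseteq> F. ?U G) =
      (\<Sum>G\<in>flats_of_rank N 1. \<Sum>F | F \<in> flats_of_rank N 2 \<and> G \<subseteq> F. ?U G)"
    using finite_flats[OF N] by (intro sum.swap_restrict) auto
  finally show ?thesis by simp
qed

text \<open>The sets of rank 1 in \<open>F\<close> are its nonempty subsets. For
  \<open>i = 0\<close> this leaves the full alternating sum without the term of the empty set; for
  \<open>i > 0\<close> the binomial vanishes on nonempty sets with at most \<open>i\<close>
  elements.\<close>

lemma sum_signed_term_rank_one:
  assumes N: "matroid N" and loopless: "\<And>e. \<not> is_loop N e" and F: "F \<in> flats_of_rank N 1"
  shows "(\<Sum>A | A \<subseteq> F \<and> rk N A = 1. signed_term N w 0 A) = (\<Sum>A\<in>Pow F. (- 1) ^ card A * w A) - w {}"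
    and "0 < i \<Longrightarrow> (\<Sum>A | A \<subseteq> F \<and> rk N A = 1. signed_term N w i A) =
      (\<Sum>A | A \<subseteq> F \<and> i < card A. (- 1) ^ card A * int ((card A - 1) choose i) * w A)"
proof -
  have Fg: "F \<subseteq> ground N" and r: "rk N F = 1"
    using F by (auto simp: flats_of_rank_def is_flat_def)
  have fin: "finite F" using finite_subset_ground[OF N Fg] .
  have rk1: "rk N A = 1 \<longleftrightarrow> A \<noteq> {}" if "A \<subseteq> F" for A
    using rk_pos_if_loopless[OF N loopless order_trans[OF that Fg]] rk_mono[OF N that Fg] r
      rk_empty[OF N] by (cases "A = {}") auto
  then have eq: "{A. A \<subseteq> F \<and> rk N A = 1} = Pow F - {{}}" by auto
  have "(\<Sum>A | A \<subseteq> F \<and> rk N A = 1. signed_term N w 0 A) =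
      (\<Sum>A\<in>Pow F - {{}}. (- 1) ^ card A * w A)"
    unfolding eq by (simp add: signed_term_def)
  also have "\<dots> = (\<Sum>A\<in>Pow F. (- 1) ^ card A * w A) - w {}"
    using fin by (subst sum_diff1) auto
  finally show "(\<Sum>A | A \<subseteq> F \<and> rk N A = 1. signed_term N w 0 A) =
      (\<Sum>A\<in>Pow F. (- 1) ^ card A * w A) - w {}" .
  assume i: "0 < i"
  show "(\<Sum>A | A \<subseteq> F \<and> rk N A = 1. signed_term N w i A) =
      (\<Sum>A | A \<subseteq> F \<and> i < card A. (- 1) ^ card A * int ((card A - 1) choose i) * w A)"
  proof (rule sum.mono_neutral_cong_right)
    show "finite {A. A \<subseteq> F \<and> rk N A = 1}" using fin by simp
    show "{A. A \<subseteq> F \<and> i < card A} \<subseteq> {A. A \<subseteq> F \<and> rk N A = 1}"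
      using rk1 by auto
    show "\<forall>A\<in>{A. A \<subseteq> F \<and> rk N A = 1} - {A. A \<subseteq> F \<and> i < card A}. signed_term N w i A = 0"
      using i by (auto simp: signed_term_def binomial_eq_0)
    show "\<And>A. A \<in> {A. A \<subseteq> F \<and> i < card A} \<Longrightarrow>
        signed_term N w i A = (- 1) ^ card A * int ((card A - 1) choose i) * w A"
    proof -
      fix A assume "A \<in> {A. A \<subseteq> F \<and> i < card A}"
      then have "rk N A = 1" using rk1[of A] by auto
      then show "signed_term N w i A = (- 1) ^ card A * int ((card A - 1) choose i) * w A"
        by (simp add: signed_term_def)
    qed
  qed
qed

text \<open>A nonempty set has rank at least 1, so with at most \<open>i\<close> elements its
  binomial vanishes; the empty set drops out because \<open>i > 0\<close>.\<close>

lemma sum_signed_term_Pow: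
  assumes N: "matroid N" and loopless: "\<And>e. \<not> is_loop N e" and F: "F \<subseteq> ground N" and i: "0 < i"
  shows "(\<Sum>A\<in>Pow F. signed_term N w i A) =
    (\<Sum>A | A \<subseteq> F \<and> i < card A. (- 1) ^ card A * int ((card A - rk N A) choose i) * w A)"
proof (rule sum.mono_neutral_cong_right)
  show "finite (Pow F)" using finite_subset_ground[OF N F] by simp
  show "\<forall>A\<in>Pow F - {A. A \<subseteq> F \<and> i < card A}. signed_term N w i A = 0"
  proof
    fix A assume A: "A \<in> Pow F - {A. A \<subseteq> F \<and> i < card A}"
    have "card A - rk N A < i"
    proof (cases "A = {}")
      case False
      then have "0 < rk N A" using A F by (intro rk_pos_if_loopless[OF N loopless]) auto
      then show ?thesis using A i by auto
    qed (use i in simp)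
    then show "signed_term N w i A = 0" by (simp add: signed_term_def binomial_eq_0)
  qed
qed (auto simp: signed_term_def)

text \<open>The general formula for \<open>k = 0, 1, 2\<close>. \<open>D i\<close> is the term of
  the empty set, present only for \<open>i = 0\<close>; \<open>U i G\<close> collects the sets of
  rank 1 with closure \<open>G\<close>. In the third formula, the rank 1 sum of weight
  \<open>R - 1\<close> is merged with the correction for the flats of rank 2 above
  \<open>G\<close>.\<close>

lemma multiplicity_tutte_coeff_top:
  fixes M :: "'a rank_system" and m :: "'a set \<Rightarrow> int"
  assumes M: "matroid M" and no_coloop: "\<And>e. \<not> is_coloop M e"
  defines "N \<equiv> dual_matroid M" and "md \<equiv> dual_mult M m" and "R \<equiv> nullity M"
  defines "U \<equiv> \<lambda>i G. \<Sum>A | A \<subseteq> G \<and> rk N A = 1. signed_term N md i A"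
  defines "D \<equiv> \<lambda>i. if i = 0 then md {} else 0"
  shows "multiplicity_tutte_coeff M m i (int R) = (- 1) ^ i * D i"
    and "multiplicity_tutte_coeff M m i (int R - 1) =
      (- 1) ^ (i + 1) * (int R * D i + (\<Sum>G\<in>flats_of_rank N 1. U i G))"
    and "multiplicity_tutte_coeff M m i (int R - 2) =
      (- 1) ^ i * ((int (R choose 2) - int (card (flats_of_rank N 2))) * D i
        - (\<Sum>G\<in>flats_of_rank N 1.
            (int (card {F \<in> flats_of_rank N 2. G \<subseteq> F}) - int R + 1) * U i G)
        + (\<Sum>F\<in>flats_of_rank N 2. \<Sum>A\<in>Pow F. signed_term N md i A))"
proof -
  have N: "matroid N" using matroid_dual[OF M] by (simp add: N_def)
  have g: "ground N = ground M" by (simp add: N_def ground_dual)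
  have loopless: "\<not> is_loop N e" for e using no_coloop[of e] by (simp add: is_coloop_def N_def)
  define S where "S j = (\<Sum>A | A \<subseteq> ground M \<and> rk N A = j. signed_term N md i A)" for j
  have coeff: "multiplicity_tutte_coeff M m i (int R - int k) =
      (- 1) ^ (k + i) * (\<Sum>j\<le>k. int ((R - j) choose (k - j)) * S j)" for k
    using multiplicity_tutte_coeff_eq[OF M] by (simp add: S_def N_def md_def R_def)
  have empty: "signed_term N md i {} = D i"
    by (simp add: signed_term_def D_def rk_empty[OF N] binomial_eq_0)
  have "A \<subseteq> ground M \<and> rk N A = 0 \<longleftrightarrow> A = {}" for A
    using rk_pos_if_loopless[OF N loopless, of A] rk_empty[OF N] g by (cases "A = {}") simp_all
  then have S0: "S 0 = D i" by (simp add: S_def empty)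
  have S1: "S 1 = (\<Sum>G\<in>flats_of_rank N 1. U i G)"
    unfolding S_def U_def g[symmetric]
    by (subst sum_rank_eq_sum_flats[OF N is_flat_ground[OF N]], intro sum.cong)
       (auto simp: flats_of_rank_def is_flat_def)
  have S2: "S 2 = (\<Sum>F\<in>flats_of_rank N 2. \<Sum>A\<in>Pow F. signed_term N md i A)
      - int (card (flats_of_rank N 2)) * D i
      - (\<Sum>G\<in>flats_of_rank N 1. int (card {F \<in> flats_of_rank N 2. G \<subseteq> F}) * U i G)"
    using sum_rank_two[OF N loopless, of "signed_term N md i"]
    by (simp add: S_def U_def g empty)
  \<comment> \<open>For \<open>R = 0\<close> the truncated \<open>R - 1\<close> is 0 and not -1, but
    then no set has rank 1 and \<open>S 1\<close> vanishes.\<close>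
  have R1: "int (R - 1) * S 1 = (int R - 1) * S 1"
  proof (cases "R = 0")
    case True
    have "rk N A \<noteq> 1" if "A \<subseteq> ground M" for A
      using rk_dual_le_nullity[OF M that] True by (simp add: N_def R_def)
    then have none: "{A. A \<subseteq> ground M \<and> rk N A = 1} = {}" by blast
    show ?thesis unfolding S_def none by simp
  qed (simp add: of_nat_diff)
  show "multiplicity_tutte_coeff M m i (int R) = (- 1) ^ i * D i"
    using coeff[of 0] S0 by simp
  show "multiplicity_tutte_coeff M m i (int R - 1) =
      (- 1) ^ (i + 1) * (int R * D i + (\<Sum>G\<in>flats_of_rank N 1. U i G))"
    using coeff[of 1] S0 S1 by simp
  have "multiplicity_tutte_coeff M m i (int R - 2) =
      (- 1) ^ i * (int (R choose 2) * S 0 + int (R - 1) * S 1 + S 2)"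
    using coeff[of 2] by (simp add: numeral_2_eq_2)
  moreover have "(\<Sum>G\<in>flats_of_rank N 1.
        (int (card {F \<in> flats_of_rank N 2. G \<subseteq> F}) - int R + 1) * U i G) =
      (\<Sum>G\<in>flats_of_rank N 1. int (card {F \<in> flats_of_rank N 2. G \<subseteq> F}) * U i G)
      - (int R - 1) * (\<Sum>G\<in>flats_of_rank N 1. U i G)"
    unfolding sum_distrib_left sum_subtractf[symmetric]
    by (intro sum.cong refl) (simp add: algebra_simps)
  ultimately show "multiplicity_tutte_coeff M m i (int R - 2) =
      (- 1) ^ i * ((int (R choose 2) - int (card (flats_of_rank N 2))) * D i
        - (\<Sum>G\<in>flats_of_rank N 1.
            (int (card {F \<in> flats_of_rank N 2. G \<subseteq> F}) - int R + 1) * U i G)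
        + (\<Sum>F\<in>flats_of_rank N 2. \<Sum>A\<in>Pow F. signed_term N md i A))"
    unfolding R1 unfolding S0 S1 S2
    by (simp only: left_diff_distrib) simp
qed

section \<open>The six coefficient formulas\<close>

theorem theorem3p5:
  fixes M :: "'a rank_system" and m :: "'a set \<Rightarrow> int"
    and X :: "'a set" and n :: int and md :: "'a set \<Rightarrow> int"
    and b :: "nat \<Rightarrow> int \<Rightarrow> int" and F1 F1' F2 :: "'a set set"
    and s_del s_con :: "'a set \<Rightarrow> int"
  assumes mult: "multiplicity_matroid M m"
    and no_coloop: "\<And>e. \<not> is_coloop M e"
    and X: "X = ground M"
    and n: "n = int (card X) - int (total_rank M)"
    and b: "b = multiplicity_tutte_coeff M m"
    and md: "md = dual_mult M m"
    and F1: "F1 = flats_of_rank (dual_matroid M) 1"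
    and F1': "F1' = cyclic_flats_of_rank (dual_matroid M) 1"
    and F2: "F2 = flats_of_rank (dual_matroid M) 2"
    and s_del: "s_del = (\<lambda>F. int (num_series (restrict_matroid M (X - F))))"
    and s_con: "s_con = (\<lambda>F. int (num_series (contract_matroid M (X - F))))"
  shows "b 0 n = m X \<and>
    b 0 (n - 1) =
      (int (num_series M) - n) * m X
      + (\<Sum>F\<in>F1. \<Sum>A\<in>Pow F. (- 1) ^ (card A + 1) * md A) \<and>
    b 0 (n - 2) =
      (int (nullity M choose 2) - (n - 1) * int (num_series M) + (\<Sum>F\<in>F2. (s_con F - 1))) * m X
      + (\<Sum>F\<in>F1. (s_del F - n + 1) * (\<Sum>A\<in>Pow F. (- 1) ^ (card A + 1) * md A))
      + (\<Sum>F\<in>F2. \<Sum>A\<in>Pow F. (- 1) ^ card A * md A) \<and>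
    b 1 (n - 1) =
      (\<Sum>F\<in>F1'. \<Sum>A | A \<subseteq> F \<and> card A \<ge> 2. (- 1) ^ card A * (int (card A) - 1) * md A) \<and>
    b 1 (n - 2) =
      (\<Sum>F\<in>F1'. (s_del F - n + 1) *
          (\<Sum>A | A \<subseteq> F \<and> card A \<ge> 2. (- 1) ^ card A * (int (card A) - 1) * md A))
      + (\<Sum>F\<in>F2. \<Sum>A | A \<subseteq> F \<and> card A \<ge> 2.
          (- 1) ^ (card A + 1) * (int (total_rank M) - int (rk M (X - A))) * md A) \<and>
    b 2 (n - 2) =
      (\<Sum>F\<in>F1'. (s_del F - n + 1) *
          (\<Sum>A | A \<subseteq> F \<and> card A \<ge> 3.
             (- 1) ^ (card A + 1) * int ((card A - 1) choose 2) * md A))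
      + (\<Sum>F\<in>F2. \<Sum>A | A \<subseteq> F \<and> card A \<ge> 3.
          (- 1) ^ card A * int ((total_rank M - rk M (X - A)) choose 2) * md A)"
proof -
  have M: "matroid M" using mult by (simp add: multiplicity_matroid_def)
  define N where "N = dual_matroid M"
  have N: "matroid N" using matroid_dual[OF M] by (simp add: N_def)
  have loopless: "\<not> is_loop N e" for e using no_coloop[of e] by (simp add: is_coloop_def N_def)
  define U where "U i G = (\<Sum>A | A \<subseteq> G \<and> rk N A = 1. signed_term N md i A)" for i G
  define W where "W i F = (\<Sum>A\<in>Pow F. signed_term N md i A)" for i F
  define E where "E F = (\<Sum>A\<in>Pow F. (- 1) ^ card A * md A)" for F
  have fin: "finite F1" "finite F2" using finite_flats[OF N] by (simp_all add: F1 F2 N_def)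
  have ground: "F \<subseteq> X" if "F \<in> F1 \<or> F \<in> F2" for F
    using that by (auto simp: F1 F2 X flats_of_rank_def is_flat_def ground_dual)

  have nR: "n = int (nullity M)"
    using rk_le_card[OF M order_refl] by (simp add: n nullity_def X total_rank_def of_nat_diff)
  have md_empty: "md {} = m X" by (simp add: md dual_mult_def X)
  \<comment> \<open>The rank differences in the statement are nullities in the dual, the form in
    which they occur in \<open>signed_term\<close>.\<close>
  have null: "int (total_rank M) - int (rk M (X - A)) = int (card A - rk N A)"
      "total_rank M - rk M (X - A) = card A - rk N A" if "A \<subseteq> X" for A
    using rk_dual[OF M, of A] rk_le_card[OF N, of A] that
    by (simp_all add: X N_def ground_dual)
  have s: "int (num_series M) = int (card F1)"
    using num_series_eq_card_flats[OF M no_coloop] by (simp add: F1)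
  have s_del_eq: "s_del G = int (card {F \<in> F2. G \<subseteq> F})" if "G \<in> F1" for G
  proof -
    have G: "is_flat (dual_matroid M) G" "rk (dual_matroid M) G + 1 = 2"
      using that by (simp_all add: F1 flats_of_rank_def)
    show ?thesis using num_series_restrict[OF M G(1)] unfolding G(2) by (simp add: s_del X F2)
  qed
  have s_con_eq: "s_con F = int (card {G \<in> F1. G \<subseteq> F})" if "F \<in> F2" for F
    using that num_series_contract[OF M no_coloop, of F]
    by (simp add: s_con X F1 F2 flats_of_rank_def)
  \<comment> \<open>Double counting of the pairs formed by a flat of rank 1 and a flat of rank 2
    containing it.\<close>
  have s_swap: "(\<Sum>F\<in>F2. s_con F) = (\<Sum>G\<in>F1. s_del G)"
  proof -
    have "(\<Sum>F\<in>F2. s_con F) = (\<Sum>F\<in>F2. \<Sum>G | G \<in> F1 \<and> G \<subseteq> F. 1)"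
      by (simp add: s_con_eq)
    also have "\<dots> = (\<Sum>G\<in>F1. \<Sum>F | F \<in> F2 \<and> G \<subseteq> F. 1)"
      by (rule sum.swap_restrict[OF fin(2,1)])
    also have "\<dots> = (\<Sum>G\<in>F1. s_del G)" by (simp add: s_del_eq)
    finally show ?thesis .
  qed

  have b_n: "b i n = (- 1) ^ i * (if i = 0 then m X else 0)" for i
    using multiplicity_tutte_coeff_top(1)[OF M no_coloop] by (simp add: b nR md_empty flip: md)
  have b_n1: "b i (n - 1) = (- 1) ^ (i + 1) * (n * (if i = 0 then m X else 0) + (\<Sum>G\<in>F1. U i G))" for i
    using multiplicity_tutte_coeff_top(2)[OF M no_coloop, of m i]
    unfolding b nR U_def N_def F1 md md_empty[unfolded md] .
  have b_n2: "b i (n - 2) = (- 1) ^ i *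
      ((int (nullity M choose 2) - int (card F2)) * (if i = 0 then m X else 0)
        - (\<Sum>G\<in>F1. (s_del G - n + 1) * U i G) + (\<Sum>F\<in>F2. W i F))" for i
  proof -
    have "(\<Sum>G\<in>F1. (s_del G - n + 1) * U i G) =
        (\<Sum>G\<in>F1. (int (card {F \<in> F2. G \<subseteq> F}) - n + 1) * U i G)"
      by (intro sum.cong) (simp_all add: s_del_eq)
    then show ?thesis
      using multiplicity_tutte_coeff_top(3)[OF M no_coloop, of m i]
      unfolding b nR U_def W_def N_def F1 F2 md md_empty[unfolded md] by simp
  qed

  \<comment> \<open>The excluded empty set contributes \<open>- m X\<close>. These corrections bring
    \<open>num_series M\<close> and \<open>s_con\<close> into the coefficients of
    \<open>m X\<close>.\<close>
  have U0: "U 0 G = E G - m X" if "G \<in> F1" for G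
    using sum_signed_term_rank_one(1)[OF N loopless, of G md] that
    by (simp add: U_def E_def F1 N_def md_empty)
  have U1: "U 1 G = (\<Sum>A | A \<subseteq> G \<and> card A \<ge> 2. (- 1) ^ card A * (int (card A) - 1) * md A)"
    if "G \<in> F1" for G
  proof -
    have "U 1 G = (\<Sum>A | A \<subseteq> G \<and> 1 < card A. (- 1) ^ card A * int ((card A - 1) choose 1) * md A)"
      using sum_signed_term_rank_one(2)[OF N loopless, of G 1 md] that
      by (simp add: U_def F1 N_def)
    also have "\<dots> = (\<Sum>A | A \<subseteq> G \<and> card A \<ge> 2. (- 1) ^ card A * (int (card A) - 1) * md A)"
      by (intro sum.cong) (auto simp: of_nat_diff)
    finally show ?thesis .
  qed
  have U2: "U 2 G =
      - (\<Sum>A | A \<subseteq> G \<and> card A \<ge> 3. (- 1) ^ (card A + 1) * int ((card A - 1) choose 2) * md A)"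
    if "G \<in> F1" for G
  proof -
    have "U 2 G = (\<Sum>A | A \<subseteq> G \<and> 2 < card A. (- 1) ^ card A * int ((card A - 1) choose 2) * md A)"
      using sum_signed_term_rank_one(2)[OF N loopless, of G 2 md] that
      by (simp add: U_def F1 N_def)
    also have "\<dots> =
        - (\<Sum>A | A \<subseteq> G \<and> card A \<ge> 3. (- 1) ^ (card A + 1) * int ((card A - 1) choose 2) * md A)"
      unfolding sum_negf[symmetric] by (intro sum.cong) auto
    finally show ?thesis .
  qed
  have W0: "W 0 F = E F" for F by (simp add: W_def E_def signed_term_def)
  have W: "W i F = (\<Sum>A | A \<subseteq> F \<and> i < card A. (- 1) ^ card A * int ((card A - rk N A) choose i) * md A)"
    if "F \<in> F2" "0 < i" for i F
    using sum_signed_term_Pow[OF N loopless, of F i md] ground[of F] that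
    by (simp add: W_def X N_def ground_dual)
  have W1: "W 1 F = - (\<Sum>A | A \<subseteq> F \<and> card A \<ge> 2.
      (- 1) ^ (card A + 1) * (int (total_rank M) - int (rk M (X - A))) * md A)"
    if F: "F \<in> F2" for F
    unfolding W[OF F zero_less_one] sum_negf[symmetric]
    using ground[of F] F by (intro sum.cong) (auto simp: null(1))
  have W2: "W 2 F = (\<Sum>A | A \<subseteq> F \<and> card A \<ge> 3.
      (- 1) ^ card A * int ((total_rank M - rk M (X - A)) choose 2) * md A)"
    if F: "F \<in> F2" for F
    unfolding W[OF F zero_less_numeral]
    using ground[of F] F by (intro sum.cong) (auto simp: null(2))

  \<comment> \<open>A noncyclic flat of rank 1 has at most one element, so it contributes nothing to
    the formulas that only involve sets of two or more elements.\<close>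
  have cyclic: "(\<Sum>G\<in>F1. h G) = (\<Sum>G\<in>F1'. h G)"
    if h: "\<And>G. finite G \<Longrightarrow> card G \<le> 1 \<Longrightarrow> h G = 0" for h :: "'a set \<Rightarrow> int"
  proof (rule sum.mono_neutral_right)
    show "F1' \<subseteq> F1"
      using cyclic_flats_of_rank_one(1)[OF N loopless] by (simp add: F1 F1' N_def)
    show "\<forall>G\<in>F1 - F1'. h G = 0"
    proof
      fix G assume G: "G \<in> F1 - F1'"
      then have "G \<subseteq> X" using ground by blast
      then have "finite G" using finite_subset_ground[OF M] by (simp add: X)
      moreover have "card G \<le> 1"
        using cyclic_flats_of_rank_one(2)[OF N loopless, of G] G by (simp add: F1 F1' N_def)
      ultimately show "h G = 0" by (rule h)
    qed
  qed (rule fin)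
  \<comment> \<open>Finiteness of \<open>G\<close> matters since \<open>card\<close> is 0 on
    infinite sets, which would make the bound on \<open>card G\<close> void.\<close>
  have small: "{A. A \<subseteq> G \<and> k \<le> card A} = {}" if "finite G" "card G \<le> 1" "2 \<le> k" for G :: "'a set" and k
  proof -
    have "\<not> k \<le> card A" if "A \<subseteq> G" for A
      using card_mono[OF \<open>finite G\<close> that] \<open>card G \<le> 1\<close> \<open>2 \<le> k\<close> by linarith
    then show ?thesis by blast
  qed

  have E: "(\<Sum>A\<in>Pow F. (- 1) ^ (card A + 1) * md A) = - E F" for F
    by (simp add: E_def sum_negf)
  have "b 0 n = m X" by (simp add: b_n)
  moreover have "b 0 (n - 1) = (int (num_series M) - n) * m X
      + (\<Sum>F\<in>F1. \<Sum>A\<in>Pow F. (- 1) ^ (card A + 1) * md A)"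
    unfolding b_n1 E s by (simp add: U0 sum_subtractf sum_negf algebra_simps)
  moreover have "b 0 (n - 2) =
      (int (nullity M choose 2) - (n - 1) * int (num_series M) + (\<Sum>F\<in>F2. (s_con F - 1))) * m X
      + (\<Sum>F\<in>F1. (s_del F - n + 1) * (\<Sum>A\<in>Pow F. (- 1) ^ (card A + 1) * md A))
      + (\<Sum>F\<in>F2. \<Sum>A\<in>Pow F. (- 1) ^ card A * md A)"
  proof -
    have "(\<Sum>G\<in>F1. (s_del G - n + 1) * U 0 G) =
        (\<Sum>G\<in>F1. (s_del G - n + 1) * E G) - (\<Sum>G\<in>F1. s_del G - n + 1) * m X"
      unfolding sum_distrib_right sum_subtractf[symmetric]
      by (intro sum.cong refl) (simp add: U0 right_diff_distrib)
    \<comment> \<open>Together with \<open>- int (card F2)\<close> from \<open>b_n2\<close>, the sum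
      of \<open>s_con F\<close> becomes the sum of \<open>s_con F - 1\<close> in the coefficient of
      \<open>m X\<close>.\<close>
    moreover have "(\<Sum>G\<in>F1. s_del G - n + 1) = (\<Sum>F\<in>F2. s_con F) - (n - 1) * int (card F1)"
      by (simp add: s_swap sum.distrib sum_subtractf algebra_simps)
    ultimately show ?thesis
      unfolding b_n2 E W0 E_def[symmetric] s
      by (simp add: sum_subtractf sum_negf algebra_simps)
  qed
  moreover have "b 1 (n - 1) =
      (\<Sum>F\<in>F1'. \<Sum>A | A \<subseteq> F \<and> card A \<ge> 2. (- 1) ^ card A * (int (card A) - 1) * md A)"
    unfolding b_n1 by (subst cyclic[symmetric]) (simp_all add: small U1[simplified])
  moreover have "b 1 (n - 2) =
      (\<Sum>F\<in>F1'. (s_del F - n + 1) *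
          (\<Sum>A | A \<subseteq> F \<and> card A \<ge> 2. (- 1) ^ card A * (int (card A) - 1) * md A))
      + (\<Sum>F\<in>F2. \<Sum>A | A \<subseteq> F \<and> card A \<ge> 2.
          (- 1) ^ (card A + 1) * (int (total_rank M) - int (rk M (X - A))) * md A)"
  proof -
    \<comment> \<open>The odd index reverses the signs of \<open>b_n2\<close>, and the empty set
      contributes nothing because \<open>i > 0\<close>.\<close>
    have "b 1 (n - 2) = (\<Sum>G\<in>F1. (s_del G - n + 1) * U 1 G) - (\<Sum>F\<in>F2. W 1 F)"
      by (simp add: b_n2)
    then show ?thesis
      by (subst cyclic[symmetric]) (simp_all only: small U1 W1 sum_negf cong: sum.cong, simp_all)
  qed
  moreover have "b 2 (n - 2) =
      (\<Sum>F\<in>F1'. (s_del F - n + 1) *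
          (\<Sum>A | A \<subseteq> F \<and> card A \<ge> 3.
             (- 1) ^ (card A + 1) * int ((card A - 1) choose 2) * md A))
      + (\<Sum>F\<in>F2. \<Sum>A | A \<subseteq> F \<and> card A \<ge> 3.
          (- 1) ^ card A * int ((total_rank M - rk M (X - A)) choose 2) * md A)"
  proof -
    \<comment> \<open>For the even index the signs of \<open>b_n2\<close> stay, and the minus sign
      in \<open>U2\<close> makes the first sum positive.\<close>
    have "b 2 (n - 2) = - (\<Sum>G\<in>F1. (s_del G - n + 1) * U 2 G) + (\<Sum>F\<in>F2. W 2 F)"
      by (simp add: b_n2)
    then show ?thesis
      by (subst cyclic[symmetric])
        (simp_all only: small U2 W2 sum_negf mult_minus_right minus_minus cong: sum.cong, simp_all)
  qed
  ultimately show ?thesis by blast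
qed

end
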